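(* For every sequence $\{t_n\}_{n\ge 1}$ of positive real numbers there exists a sequence $\Phi_*=\{\Phi_n\}_{n\ge 1}$ of matrices in $SL(2,\mathbb{R})$ such that $t_n\in\mathfrak B(\Phi_* )$ for every $n$.
   Context: For $t\in\mathbb{R}$, $H(t)=\begin{pmatrix}1&t\\0&1\end{pmatrix}$. For a sequence $\Phi_*=\{\Phi_n\}_{n\ge1}$ in $SL(2,\mathbb{R})$, put $P_n(t)=\Phi_nH(t)\,\Phi_{n-1}H(t)\cdots\Phi_1H(t)$ and $\mathfrak B(\Phi_* )=\{t\ge 0:\ \sup_{n\ge 1}\|P_n(t)\|<\infty\}$, where $\|\cdot\|$ is the operator norm induced by the Euclidean norm. *)

theory Defs
  imports "HOL-Analysis.Analysis"
begin

definition SL2 :: "(real^2^2) set" where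
  "SL2 = {A. det A = 1}"

definition H :: "real \<Rightarrow> real^2^2" where
  "H t = vector [vector [1, t], vector [0, 1]]"

text \<open>Sequences indexed by \<open>n \<ge> 1\<close> are functions on \<^typ>\<open>nat\<close> whose value at \<open>0\<close> is never used;
  \<open>P \<Phi> t 0\<close> is the empty product.\<close>

primrec P :: "(nat \<Rightarrow> real^2^2) \<Rightarrow> real \<Rightarrow> nat \<Rightarrow> real^2^2" where
  "P \<Phi> t 0 = mat 1"
| "P \<Phi> t (Suc n) = \<Phi> (Suc n) ** H t ** P \<Phi> t n"

text \<open>The finiteness of the supremum is expressed by \<^const>\<open>bdd_above\<close>, since \<^const>\<open>Sup\<close> on
  \<^typ>\<open>real\<close> is unspecified for unbounded sets.\<close>

definition bounded_params :: "(nat \<Rightarrow> real^2^2) \<Rightarrow> real set" where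
  "bounded_params \<Phi> = {t. t \<ge> 0 \<and> bdd_above ((\<lambda>n. onorm ((*v) (P \<Phi> t n))) ` {1..})}"

end

theory Submission
  imports Defs "HOL-Computational_Algebra.Primes"
begin

text \<open>
  All kicks can be taken to be rotations, arranged in the order of the ruler sequence:
  \<open>\<Phi> n = R (multiplicity 2 n)\<close>. For such a sequence the words \<open>V m = H \<Phi>(2^m - 1) H \<dots> \<Phi>(1) H\<close>
  satisfy \<open>V (m+1) = V m ** R m ** V m\<close> for every value of the parameter, and \<open>V m\<close> involves only
  \<open>R 0, \<dots>, R (m-1)\<close>. Hence \<open>R m\<close> may be chosen after looking at \<open>V m\<close>.

  The point is that for any \<open>A\<close> of determinant \<open>1\<close> there is a rotation \<open>R\<close> for which \<open>A ** R ** A\<close> is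
  again a rotation (\<open>rotation_balancing\<close>): pick \<open>R\<close> with \<open>R ** A\<close> of trace zero, so that
  \<open>(R ** A)^2 = -1\<close> by Cayley--Hamilton. Choosing \<open>R m\<close> in this way for \<open>A = V m (t (m+1))\<close> makes
  \<open>V (m+1)\<close> a rotation at \<open>t (m+1)\<close>. It does no harm at the parameters treated before: there \<open>V m\<close> is
  already a rotation, and so is any product of it with rotations.

  Fix \<open>i\<close> and work at \<open>t i\<close>. The ruler sequence is \<open>2^i\<close>-periodic away from the multiples of \<open>2^i\<close>, so
  \<open>P (q * 2^i + r) = P r ** P (q * 2^i)\<close> for \<open>r < 2^i\<close>. The second factor is a product of rotations
  \<open>\<Phi>(k * 2^i) ** V i\<close>, and the first takes only finitely many values, so the products are bounded.
\<close>

section \<open>Plane rotations\<close>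

definition SO2 :: "(real^2^2) set" where
  "SO2 = {A. orthogonal_matrix A \<and> det A = 1}"

lemma SO2_mult: "A \<in> SO2 \<Longrightarrow> B \<in> SO2 \<Longrightarrow> A ** B \<in> SO2"
  by (simp add: SO2_def orthogonal_matrix_mul det_mul)

lemma mat_1_in_SO2: "mat 1 \<in> SO2"
  by (simp add: SO2_def orthogonal_matrix_id)

lemma SO2_subset_SL2: "SO2 \<subseteq> SL2"
  by (auto simp: SO2_def SL2_def)

lemma norm_SO2_mult_vec: "A \<in> SO2 \<Longrightarrow> norm (A *v x) = norm x"
  by (metis (no_types, lifting) SO2_def mem_Collect_eq orthogonal_transformation_norm
      orthogonal_transformation_matrix matrix_of_matrix_vector_mul matrix_vector_mul_linear)

lemma SO2_iff:
  "A \<in> SO2 \<longleftrightarrow> A$2$2 = A$1$1 \<and> A$2$1 = - A$1$2 \<and> (A$1$1)\<^sup>2 + (A$1$2)\<^sup>2 = 1"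
proof -
  have orth: "orthogonal_matrix A \<longleftrightarrow>
      (A$1$1)\<^sup>2 + (A$2$1)\<^sup>2 = 1 \<and> (A$1$2)\<^sup>2 + (A$2$2)\<^sup>2 = 1 \<and> A$1$1 * A$1$2 + A$2$1 * A$2$2 = 0"
    by (auto simp: orthogonal_matrix vec_eq_iff forall_2 matrix_matrix_mult_def sum_2
        transpose_def mat_def power2_eq_square algebra_simps)
  show ?thesis
  proof
    assume "A \<in> SO2"
    then have eqs: "(A$1$1)\<^sup>2 + (A$2$1)\<^sup>2 = 1" "(A$1$2)\<^sup>2 + (A$2$2)\<^sup>2 = 1"
        "A$1$1 * A$2$2 - A$1$2 * A$2$1 = 1"
      by (auto simp: SO2_def orth det_2)
    have "(A$2$2 - A$1$1)\<^sup>2 + (A$2$1 + A$1$2)\<^sup>2 = 0"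
      using eqs by (simp add: power2_eq_square algebra_simps)
    then have "A$2$2 = A$1$1 \<and> A$2$1 = - A$1$2"
      by (simp add: sum_power2_eq_zero_iff)
    then show "A$2$2 = A$1$1 \<and> A$2$1 = - A$1$2 \<and> (A$1$1)\<^sup>2 + (A$1$2)\<^sup>2 = 1"
      using eqs(2) by simp
  qed (auto simp: SO2_def orth det_2 power2_eq_square algebra_simps)
qed

text \<open>The trace of \<open>R ** A\<close> is linear in the pair of entries \<open>(x, y)\<close> of the rotation \<open>R\<close>, so it vanishes for
  some rotation. Then \<open>(R ** A)^2 = -1\<close>, that is, \<open>A ** R ** A\<close> is minus the inverse of \<open>R\<close>.\<close>

lemma rotation_balancing:
  assumes "A \<in> SL2"
  shows "\<exists>R\<in>SO2. A ** R ** A \<in> SO2"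
proof -
  define a b c d where abcd: "a = A$1$1" "b = A$1$2" "c = A$2$1" "d = A$2$2"
  have det: "a * d - b * c = 1"
    using assms by (simp add: SL2_def det_2 abcd)
  define r where "r = sqrt ((c - b)\<^sup>2 + (a + d)\<^sup>2)"
  have "(c - b)\<^sup>2 + (a + d)\<^sup>2 \<noteq> 0"
  proof
    assume "(c - b)\<^sup>2 + (a + d)\<^sup>2 = 0"
    then have "c = b" "d = - a"
      by (auto simp: sum_power2_eq_zero_iff)
    then have "a\<^sup>2 + b\<^sup>2 = -1"
      using det by (simp add: power2_eq_square)
    then show False
      using sum_power2_ge_zero[of a b] by simp
  qed
  then have r: "r \<noteq> 0" "r\<^sup>2 = (c - b)\<^sup>2 + (a + d)\<^sup>2"
    by (auto simp: r_def)
  define x y where xy: "x = (c - b) / r" "y = (a + d) / r"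
  have unit: "x\<^sup>2 + y\<^sup>2 = 1"
    using r(1) by (simp add: xy power_divide flip: add_divide_distrib r(2))
  have trace: "x * (a + d) = y * (c - b)"
    by (simp add: xy)
  define R :: "real^2^2" where "R = vector [vector [x, -y], vector [y, x]]"
  have R_entries: "R$1$1 = x" "R$1$2 = -y" "R$2$1 = y" "R$2$2 = x"
    by (simp_all add: R_def)
  have "R \<in> SO2"
    using unit by (simp add: SO2_iff R_entries)
  have ARA: "(A ** R ** A)$1$1 = -x" "(A ** R ** A)$1$2 = -y"
      "(A ** R ** A)$2$1 = y" "(A ** R ** A)$2$2 = -x"
    unfolding matrix_matrix_mult_def
    by (simp_all add: sum_2 R_entries flip: abcd) (use det trace in algebra)+
  have "A ** R ** A \<in> SO2"
    using unit by (simp add: SO2_iff ARA)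
  with \<open>R \<in> SO2\<close> show ?thesis by blast
qed

section \<open>Products along the ruler sequence\<close>

text \<open>Below \<open>2^i\<close> the 2-adic valuation is less than \<open>i\<close>, so adding a multiple of \<open>2^i\<close> preserves it.\<close>

lemma multiplicity_2_add_multiple:
  fixes j q i :: nat
  assumes "0 < j" "j < 2 ^ i"
  shows "multiplicity 2 (q * 2 ^ i + j) = multiplicity 2 j"
proof (cases "q = 0")
  case False
  have "\<not> 2 ^ i dvd j"
    using assms by (auto dest: dvd_imp_le)
  then have "multiplicity 2 j < i"
    using assms by (simp add: multiplicity_lessI)
  also have "i \<le> multiplicity 2 (q * 2 ^ i)"
    using False by (intro multiplicity_geI) auto
  finally show ?thesis
    using assms False by (subst add.commute) (intro multiplicity_sum_lt, auto)
qed simp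

lemma P_ruler_split:
  assumes "r < 2 ^ i"
  shows "P (\<lambda>n. R (multiplicity 2 n)) s (q * 2 ^ i + r)
       = P (\<lambda>n. R (multiplicity 2 n)) s r ** P (\<lambda>n. R (multiplicity 2 n)) s (q * 2 ^ i)"
  using assms
proof (induction r)
  case (Suc r)
  then have "multiplicity 2 (Suc (q * 2 ^ i + r)) = multiplicity 2 (Suc r)"
    using multiplicity_2_add_multiple[of "Suc r" i q] by simp
  with Suc show ?case
    by (simp add: matrix_mul_assoc)
qed simp

text \<open>The word \<open>V m\<close> of the introduction, as a function of the parameter.\<close>

definition dyadic_word :: "(nat \<Rightarrow> real^2^2) \<Rightarrow> nat \<Rightarrow> real \<Rightarrow> real^2^2" where
  "dyadic_word R m s = H s ** P (\<lambda>n. R (multiplicity 2 n)) s (2 ^ m - 1)"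

lemma P_ruler_next_multiple:
  "P (\<lambda>n. R (multiplicity 2 n)) s (Suc q * 2 ^ i)
     = R (multiplicity 2 (Suc q * 2 ^ i)) ** dyadic_word R i s
       ** P (\<lambda>n. R (multiplicity 2 n)) s (q * 2 ^ i)"
proof -
  define k where "k = q * 2 ^ i + (2 ^ i - 1)"
  have "Suc q * 2 ^ i = Suc k"
    by (simp add: k_def)
  moreover have "P (\<lambda>n. R (multiplicity 2 n)) s k
      = P (\<lambda>n. R (multiplicity 2 n)) s (2 ^ i - 1) ** P (\<lambda>n. R (multiplicity 2 n)) s (q * 2 ^ i)"
    unfolding k_def by (rule P_ruler_split) simp
  ultimately show ?thesis
    by (simp only: P.simps dyadic_word_def matrix_mul_assoc)
qed

lemma dyadic_word_0: "dyadic_word R 0 s = H s"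
  by (simp add: dyadic_word_def)

lemma dyadic_word_Suc:
  "dyadic_word R (Suc m) s = dyadic_word R m s ** R m ** dyadic_word R m s"
proof -
  have "2 ^ Suc m - 1 = 1 * 2 ^ m + (2 ^ m - 1 :: nat)"
    by simp
  then have "dyadic_word R (Suc m) s
      = dyadic_word R m s ** P (\<lambda>n. R (multiplicity 2 n)) s (Suc 0 * 2 ^ m)"
    using P_ruler_split[of "2 ^ m - 1" m R s 1]
    by (simp add: dyadic_word_def matrix_mul_assoc)
  also have "multiplicity 2 (Suc 0 * 2 ^ m :: nat) = m"
    by simp
  ultimately show ?thesis
    by (simp only: P_ruler_next_multiple) (simp add: matrix_mul_assoc)
qed

lemma dyadic_word_in_SL2:
  assumes "\<And>m. R m \<in> SO2"
  shows "dyadic_word R m s \<in> SL2"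
proof (induction m)
  case 0
  show ?case
    by (simp add: dyadic_word_0 SL2_def H_def det_2)
next
  case (Suc m)
  then show ?case
    using assms[of m] by (simp add: dyadic_word_Suc SL2_def SO2_def det_mul)
qed

text \<open>If \<open>dyadic_word R i s\<close> is a rotation, the products at multiples of \<open>2^i\<close> are rotations, and every
  other product differs from one of these by one of the first \<open>2^i\<close> products.\<close>

lemma bounded_params_ruler:
  assumes R: "\<And>m. R m \<in> SO2" and word: "dyadic_word R i s \<in> SO2" and "s \<ge> 0"
  shows "s \<in> bounded_params (\<lambda>n. R (multiplicity 2 n))"
proof -
  let ?P = "P (\<lambda>n. R (multiplicity 2 n)) s"
  have multiples: "?P (q * 2 ^ i) \<in> SO2" for q
  proof (induction q)
    case (Suc q)
    then show ?case
      unfolding P_ruler_next_multiple by (intro SO2_mult R word)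
  qed (simp add: mat_1_in_SO2)
  define C where "C = Max ((\<lambda>r. onorm ((*v) (?P r))) ` {..<2 ^ i})"
  have "onorm ((*v) (?P n)) \<le> C" for n
  proof -
    define q r where qr: "q = n div 2 ^ i" "r = n mod 2 ^ i"
    have "r < 2 ^ i" and n: "n = q * 2 ^ i + r"
      unfolding qr by (simp_all only: div_mult_mod_eq) simp
    then have le_C: "onorm ((*v) (?P r)) \<le> C"
      unfolding C_def by (intro Max_ge) auto
    show ?thesis
    proof (rule onorm_le)
      fix x
      have "norm (?P n *v x) = norm (?P r *v (?P (q * 2 ^ i) *v x))"
        using P_ruler_split[OF \<open>r < 2 ^ i\<close>] n by (simp add: matrix_vector_mul_assoc)
      also have "\<dots> \<le> onorm ((*v) (?P r)) * norm (?P (q * 2 ^ i) *v x)"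
        by (intro onorm matrix_vector_mul_bounded_linear)
      also have "\<dots> \<le> C * norm x"
        using le_C by (simp add: norm_SO2_mult_vec[OF multiples] mult_right_mono)
      finally show "norm (?P n *v x) \<le> C * norm x" .
    qed
  qed
  then show ?thesis
    using \<open>s \<ge> 0\<close> by (auto simp: bounded_params_def intro!: bdd_aboveI)
qed

section \<open>Choosing the rotations\<close>

text \<open>The choice of \<open>R m\<close> depends on the word \<open>V m\<close>, which in turn depends on the earlier choices. The
  recursion is therefore run on the words; by \<open>dyadic_word_Suc\<close> they are the dyadic words of the
  resulting rotations.\<close>

lemma exists_balancing_rotations:
  "\<exists>R. (\<forall>m. R m \<in> SO2) \<and> (\<forall>m. dyadic_word R (Suc m) (t (Suc m)) \<in> SO2)"
proof -
  have "\<forall>A. \<exists>R. R \<in> SO2 \<and> (A \<in> SL2 \<longrightarrow> A ** R ** A \<in> SO2)"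
    using rotation_balancing mat_1_in_SO2 by blast
  then obtain balancer where
    balancer: "\<And>A. balancer A \<in> SO2" "\<And>A. A \<in> SL2 \<Longrightarrow> A ** balancer A ** A \<in> SO2"
    by metis
  define V where
    "V = rec_nat H (\<lambda>m W s. W s ** balancer (W (t (Suc m))) ** W s)"
  define R where "R m = balancer (V m (t (Suc m)))" for m
  have R: "R m \<in> SO2" for m
    by (simp add: R_def balancer)
  have V: "dyadic_word R m s = V m s" for m s
    by (induction m arbitrary: s) (simp_all add: dyadic_word_0 dyadic_word_Suc V_def R_def)
  have "dyadic_word R (Suc m) (t (Suc m)) \<in> SO2" for m
    using balancer(2)[OF dyadic_word_in_SL2[of R m "t (Suc m)", OF R]] by (simp add: dyadic_word_Suc V flip: R_def)
  with R show ?thesis by blast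
qed

theorem theorem2:
  fixes t :: "nat \<Rightarrow> real"
  assumes "\<forall>n\<ge>1. t n > 0"
  shows "\<exists>\<Phi> :: nat \<Rightarrow> real^2^2.
           (\<forall>n\<ge>1. \<Phi> n \<in> SL2) \<and> (\<forall>n\<ge>1. t n \<in> bounded_params \<Phi>)"
proof -
  obtain R where R: "\<And>m. R m \<in> SO2" and word: "\<And>m. dyadic_word R (Suc m) (t (Suc m)) \<in> SO2"
    using exists_balancing_rotations by blast
  have "t n \<in> bounded_params (\<lambda>k. R (multiplicity 2 k))" if "n \<ge> 1" for n
  proof (rule bounded_params_ruler[OF R])
    show "dyadic_word R n (t n) \<in> SO2"
      using word[of "n - 1"] that by simp
    show "t n \<ge> 0"
      using assms that by (simp add: less_imp_le)
  qed
  moreover have "R (multiplicity 2 n) \<in> SL2" for n :: nat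
    using R SO2_subset_SL2 by blast
  ultimately show ?thesis
    by (intro exI[of _ "\<lambda>n. R (multiplicity 2 n)"]) blast
qed

end
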